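(* Let $(\mathfrak X,d)$ be a separable, complete, convexifiable CC space and let $X$ be an integrable $\mathfrak X$-valued random element. Let $\mathfrak X'$ be the set of all continuous affine mappings $f:\mathfrak X\to\mathbb R$. Then: (i) $f(X)\in L^1_{\mathbb R}$ (i.e. $f(X)$ is an integrable real random variable) for all $f\in\mathfrak X'$; (ii) an element $m\in\mathfrak X$ is the expectation of $X$ if and only if $f(m)=Ef(X)$ for all $f\in\mathfrak X'$.
   Context: A convex combination space (CC space) is a metric space $(\mathfrak X,d)$ endowed with a convex combination operation, which to all $n\ge1$, all $\lambda_1,\dots,\lambda_n>0$ with $\sum_{i=1}^n\lambda_i=1$ and all $u_1,\dots,u_n\in\mathfrak X$ assigns an element $[\lambda_1,u_1;\dots;\lambda_n,u_n]=[\lambda_i,u_i]_{i=1}^n$ of $\mathfrak X$, with $[1,u]=u$, and such that: (CC.i) $[\lambda_i,u_i]_{i=1}^n=[\lambda_{\sigma(i)},u_{\sigma(i)}]_{i=1}^n$ for every permutation $\sigma$ of $\{1,\dots,n\}$; (CC.ii) $[\lambda_i,u_i]_{i=1}^{n+2}=\big[\lambda_1,u_1;\dots;\lambda_n,u_n;\lambda_{n+1}+\lambda_{n+2},\big[\tfrac{\lambda_{n+j}}{\lambda_{n+1}+\lambda_{n+2}},u_{n+j}\big]_{j=1}^2\big]$; (CC.iii) if $u,v\in\mathfrak X$ and $\lambda^{(k)}\to\lambda\in(0,1)$ then $[\lambda^{(k)},u;1-\lambda^{(k)},v]\to[\lambda,u;1-\lambda,v]$; (CC.iv) for $u_1,u_2,v_1,v_2\in\mathfrak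 X$ and $\lambda\in(0,1)$, $d([\lambda,u_1;1-\lambda,u_2],[\lambda,v_1;1-\lambda,v_2])\le\lambda d(u_1,v_1)+(1-\lambda)d(u_2,v_2)$; (CC.v) for each $u\in\mathfrak X$ the limit $Ku:=\lim_{n\to\infty}[n^{-1},u]_{i=1}^n$ exists in $\mathfrak X$; $K$ is called the convexification operator. Write $K(\mathfrak X)=\{Ku:u\in\mathfrak X\}$; $K$ is idempotent. $\mathfrak X$ is convexifiable if $K(\mathfrak X)=\mathfrak X$. For points of $K(\mathfrak X)$, weights in $[0,1]$ are allowed by discarding entries with weight $0$. A map $\varphi:\mathfrak X\to\mathbb R$ is convex if $\varphi([\lambda_i,x_i]_{i=1}^n)\le\sum_{i=1}^n\lambda_i\varphi(x_i)$ for all $x_i\in\mathfrak X$, $\lambda_i\in(0,1)$ with $\sum\lambda_i=1$; it is affine if $\varphi$ and $-\varphi$ are both convex. $(\Omega,\mathcal F,P)$ is a complete probability space without atoms. A random element is a map $X:\Omega\to\mathfrak X$ measurable with respect to $\mathcal F$ and the Borel $\sigma$-algebra; it is integrable if $d(u,X)$ is integrable for some (equivalently every) $u\in\mathfrak X$. A simple random element takes finitely many values; if $X=x_i$ on $\Omega_i$, where $\Omega_1,\dots,\Omega_n$ is a measurable partition of $\Omega$, write $X=[I_{\Omega_i},x_i]_{i=1}^n$ and define $EX=[P(\Omega_i),Kx_i]_{i=1}^n$. For integrable $X$: fix $u_0\in K(\mathfrak X)$ and a countable dense set $\{u_j:j\ge1\}\subset\mathfrak X$, let $\psi_n(x)=u_{m_n(x)}$,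 where $m_n(x)$ is the smallest $i\in\{0,\dots,n\}$ with $d(u_i,x)=\min_{0\le j\le n}d(u_j,x)$, and define the expectation $EX=\lim_{n\to\infty}E\psi_n(X)$ (the limit exists). *)

theory Defs
  imports "HOL-Probability.Probability" "HOL-Combinatorics.Permutations"
begin

text \<open>
  The element $[\lambda_1,u_1;\dots;\lambda_n,u_n]$ is written
  \<open>cc [(\<lambda>\<^sub>1, u\<^sub>1), \<dots>, (\<lambda>\<^sub>n, u\<^sub>n)]\<close>. Values of \<open>cc\<close> on lists that do not satisfy
  \<open>cc_weights\<close> are irrelevant.
\<close>

definition cc_weights :: "(real \<times> 'a) list \<Rightarrow> bool" where
  "cc_weights xs \<longleftrightarrow> (\<forall>p\<in>set xs. 0 < fst p) \<and> sum_list (map fst xs) = 1"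

text \<open>
  The operator is called \<open>K\<close> in the literature; its values are meaningful once the limit is
  known to exist, which is the last axiom of a convex combination space below.
\<close>

definition convexification :: "((real \<times> 'a::metric_space) list \<Rightarrow> 'a) \<Rightarrow> 'a \<Rightarrow> 'a" where
  "convexification cc u = lim (\<lambda>n. cc (replicate (Suc n) (1 / real (Suc n), u)))"

locale cc_space =
  fixes cc :: "(real \<times> 'a::metric_space) list \<Rightarrow> 'a"
  assumes cc_single: "cc [(1, u)] = u"
    and cc_permute:
      "\<lbrakk>cc_weights xs; \<sigma> permutes {..<length xs}\<rbrakk> \<Longrightarrow> cc (permute_list \<sigma> xs) = cc xs"
    and cc_assoc:
      "cc_weights (xs @ [(a, u), (b, v)]) \<Longrightarrow>
         cc (xs @ [(a, u), (b, v)]) = cc (xs @ [(a + b, cc [(a / (a + b), u), (b / (a + b), v)])])"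
    and cc_weight_continuous:
      "\<lbrakk>\<And>k. l k \<in> {0<..<1}; t \<in> {0<..<1}; l \<longlonglongrightarrow> t\<rbrakk> \<Longrightarrow>
         (\<lambda>k. cc [(l k, u), (1 - l k, v)]) \<longlonglongrightarrow> cc [(t, u), (1 - t, v)]"
    and cc_dist:
      "t \<in> {0<..<1} \<Longrightarrow>
         dist (cc [(t, u1), (1 - t, u2)]) (cc [(t, v1), (1 - t, v2)])
           \<le> t * dist u1 v1 + (1 - t) * dist u2 v2"
    and cc_convexification_exists:
      "convergent (\<lambda>n. cc (replicate (Suc n) (1 / real (Suc n), u)))"

definition cc_convexifiable :: "((real \<times> 'a::metric_space) list \<Rightarrow> 'a) \<Rightarrow> bool" where
  "cc_convexifiable cc \<longleftrightarrow> range (convexification cc) = UNIV"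

text \<open>Weights in \<open>[0, 1]\<close> are allowed by discarding the entries of weight zero.\<close>

definition cc0 :: "((real \<times> 'a) list \<Rightarrow> 'a) \<Rightarrow> (real \<times> 'a) list \<Rightarrow> 'a" where
  "cc0 cc xs = cc (filter (\<lambda>p. fst p \<noteq> 0) xs)"

definition cc_convex :: "((real \<times> 'a) list \<Rightarrow> 'a) \<Rightarrow> ('a \<Rightarrow> real) \<Rightarrow> bool" where
  "cc_convex cc \<phi> \<longleftrightarrow>
     (\<forall>xs. (\<forall>p\<in>set xs. fst p \<in> {0<..<1}) \<and> sum_list (map fst xs) = 1 \<longrightarrow>
        \<phi> (cc xs) \<le> (\<Sum>p\<leftarrow>xs. fst p * \<phi> (snd p)))"

definition cc_affine :: "((real \<times> 'a) list \<Rightarrow> 'a) \<Rightarrow> ('a \<Rightarrow> real) \<Rightarrow> bool" where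
  "cc_affine cc \<phi> \<longleftrightarrow> cc_convex cc \<phi> \<and> cc_convex cc (\<lambda>x. - \<phi> x)"

definition cc_dual :: "((real \<times> 'a::metric_space) list \<Rightarrow> 'a) \<Rightarrow> ('a \<Rightarrow> real) set" where
  "cc_dual cc = {f. continuous_on UNIV f \<and> cc_affine cc f}"

definition atomless :: "'w measure \<Rightarrow> bool" where
  "atomless M \<longleftrightarrow>
     (\<forall>A\<in>sets M. 0 < emeasure M A \<longrightarrow>
        (\<exists>B\<in>sets M. B \<subseteq> A \<and> 0 < emeasure M B \<and> emeasure M B < emeasure M A))"

definition random_element :: "'w measure \<Rightarrow> ('w \<Rightarrow> 'a::metric_space) \<Rightarrow> bool" where
  "random_element M X \<longleftrightarrow> X \<in> borel_measurable M"

definition integrable_element :: "'w measure \<Rightarrow> ('w \<Rightarrow> 'a::metric_space) \<Rightarrow> bool" where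
  "integrable_element M X \<longleftrightarrow> random_element M X \<and> (\<exists>u. integrable M (\<lambda>\<omega>. dist u (X \<omega>)))"

text \<open>\<open>Y\<close> equals \<open>x i\<close> on \<open>A i\<close>, where \<open>A 0, \<dots>, A (n - 1)\<close> is a measurable partition; cells may be
  empty and the points \<open>x i\<close> need not be distinct.\<close>

definition simple_representation ::
    "'w measure \<Rightarrow> ('w \<Rightarrow> 'a) \<Rightarrow> nat \<Rightarrow> (nat \<Rightarrow> 'w set) \<Rightarrow> (nat \<Rightarrow> 'a) \<Rightarrow> bool" where
  "simple_representation M Y n A x \<longleftrightarrow>
     (\<forall>i<n. A i \<in> sets M) \<and> disjoint_family_on A {..<n} \<and> (\<Union>i<n. A i) = space M \<and>
     (\<forall>i<n. \<forall>\<omega>\<in>A i. Y \<omega> = x i)"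

text \<open>The expectation $[P(\Omega_i), K x_i]_{i=1}^n$ of a simple random element does not depend on the
  representation.\<close>

definition simple_expectation ::
    "((real \<times> 'a::metric_space) list \<Rightarrow> 'a) \<Rightarrow> 'w measure \<Rightarrow> ('w \<Rightarrow> 'a) \<Rightarrow> 'a" where
  "simple_expectation cc M Y =
     (THE e. \<exists>n A x. simple_representation M Y n A x \<and>
        e = cc0 cc (map (\<lambda>i. (measure M (A i), convexification cc (x i))) [0..<n]))"

definition nearest_index :: "(nat \<Rightarrow> 'a::metric_space) \<Rightarrow> nat \<Rightarrow> 'a \<Rightarrow> nat" where
  "nearest_index u n x =
     (LEAST i. i \<le> n \<and> dist (u i) x = Min ((\<lambda>j. dist (u j) x) ` {..n}))"

definition nearest_approx :: "(nat \<Rightarrow> 'a::metric_space) \<Rightarrow> nat \<Rightarrow> 'a \<Rightarrow> 'a" where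
  "nearest_approx u n x = u (nearest_index u n x)"

definition approximating_sequence ::
    "((real \<times> 'a::metric_space) list \<Rightarrow> 'a) \<Rightarrow> (nat \<Rightarrow> 'a) \<Rightarrow> bool" where
  "approximating_sequence cc u \<longleftrightarrow>
     u 0 \<in> range (convexification cc) \<and> closure (u ` {1..}) = UNIV"

text \<open>\<open>m\<close> is the expectation of the integrable random element \<open>X\<close>, computed with the approximating
  sequence \<open>u\<close>: the limit of the expectations of $\psi_n(X)$ exists and equals \<open>m\<close>.\<close>

definition is_expectation ::
    "((real \<times> 'a::metric_space) list \<Rightarrow> 'a) \<Rightarrow> (nat \<Rightarrow> 'a) \<Rightarrow> 'w measure \<Rightarrow> ('w \<Rightarrow> 'a) \<Rightarrow> 'a \<Rightarrow> bool"
  where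
  "is_expectation cc u M X m \<longleftrightarrow>
     (\<lambda>n. simple_expectation cc M (\<lambda>\<omega>. nearest_approx u n (X \<omega>))) \<longlonglongrightarrow> m"

end

theory Submission
  imports Defs "HOL-Real_Asymp.Real_Asymp"
begin

text \<open>
  Convexifiability gives \<open>K = id\<close>, hence \<open>[t, x; 1 - t, x] = x\<close>, so every function
  \<open>dist _ b\<close> is convex. Replacing a convex nonexpansive function by its tangent (value plus one-sided
  directional derivative) at a point \<open>z\<close> makes it affine along all segments ending at \<open>z\<close>
  and keeps this property at points where it already held. Doing so at \<open>a\<close> and then at the
  points of a dense sequence yields in the limit a nonexpansive \<open>f \<in> cc_dual cc\<close> with
  \<open>f a - f b = dist a b\<close>; this takes the place of an embedding into a Banach space and the
  Hahn--Banach theorem.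

  Testing with such \<open>f\<close> shows that the expectation of a simple element is well defined and
  that \<open>dist (E Y) (E Z) \<le> E (dist Y Z)\<close>, so that the approximating expectations are Cauchy.
  Finally, a continuous affine function need not be Lipschitz, but it grows at most linearly,
  which is what integrability and dominated convergence require.
\<close>

section \<open>Binary convex combinations\<close>

context cc_space
begin

text \<open>Meaningful only for \<open>t\<close> strictly between 0 and 1; at other weights the list
  violates \<open>cc_weights\<close> and the axioms say nothing.\<close>

definition mix :: "real \<Rightarrow> 'a \<Rightarrow> 'a \<Rightarrow> 'a" where
  "mix t x y = cc [(t, x), (1 - t, y)]"

lemma cc_mset_cong:
  assumes "cc_weights xs" "mset ys = mset xs"
  shows "cc ys = cc xs"
proof -
  obtain p where "p permutes {..<length xs}" "permute_list p xs = ys"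
    using mset_eq_permutation[OF assms(2)] by blast
  then show ?thesis
    using cc_permute assms(1) by blast
qed

text \<open>Associativity merges only the last two entries. Induction on the length of the block
  \<open>ys\<close>: merge its last two entries within the whole list, contract the shorter block by
  the induction hypothesis, then undo the merger inside the normalised block.\<close>

lemma cc_append:
  assumes "cc_weights (xs @ ys)" "ys \<noteq> []"
  shows "cc (xs @ ys) =
    cc (xs @ [(sum_list (map fst ys), cc (map (\<lambda>(a, u). (a / sum_list (map fst ys), u)) ys))])"
  using assms
proof (induction "length ys" arbitrary: ys rule: less_induct)
  case less
  consider p where "ys = [p]" | zs p q where "ys = zs @ [p, q]"
    using less.prems(2)
    by (metis append.assoc append_Cons append_Nil rev_exhaust)
  then show ?case
  proof cases
    case (1 p)
    then have "fst p > 0"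
      using less.prems by (auto simp: cc_weights_def)
    with 1 show ?thesis
      by (cases p) (simp add: cc_single)
  next
    case (2 zs p q)
    obtain a u b v where p: "p = (a, u)" "q = (b, v)"
      by (cases p, cases q) auto
    define s where "s = sum_list (map fst ys)"
    define w where "w = cc [(a / (a + b), u), (b / (a + b), v)]"
    let ?n = "map (\<lambda>(a, u). (a / s, u))"
    have pos: "a > 0" "b > 0" "\<forall>p\<in>set zs. fst p > 0"
      using less.prems 2 p by (auto simp: cc_weights_def)
    have s: "s = sum_list (map fst zs) + a + b"
      by (simp add: s_def 2 p)
    have "sum_list (map fst zs) \<ge> 0"
      using pos by (intro sum_list_nonneg) (auto intro: less_imp_le)
    then have "s > 0"
      using s pos by simp
    have norm: "sum_list (map fst (?n ys)) = 1" if "sum_list (map fst ys) = s" for ys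
    proof -
      have "sum_list (map fst (?n ys)) = sum_list (map fst ys) / s"
        by (induction ys) (auto simp: add_divide_distrib)
      then show ?thesis
        using that \<open>s > 0\<close> by simp
    qed
    have "cc (xs @ ys) = cc ((xs @ zs) @ [(a + b, w)])"
      using cc_assoc[of "xs @ zs" a u b v] less.prems(1) by (simp add: 2 p w_def)
    also have "\<dots> = cc (xs @ (zs @ [(a + b, w)]))"
      by simp
    also have "\<dots> = cc (xs @ [(s, cc (?n (zs @ [(a + b, w)])))])"
      using less.hyps[of "zs @ [(a + b, w)]"] less.prems(1) pos
      by (auto simp: 2 p cc_weights_def s add.assoc)
    \<comment> \<open>Dividing all weights by \<open>s\<close> leaves the ratios of \<open>a\<close>
      and \<open>b\<close> to \<open>a + b\<close> unchanged, so the merged point in the normalised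
      block is again \<open>w\<close>.\<close>
    also have "cc (?n (zs @ [(a + b, w)])) = cc (?n ys)"
    proof -
      have eq: "?n ys = ?n zs @ [(a / s, u), (b / s, v)]"
        by (simp add: 2 p)
      have "cc_weights (?n ys)"
        unfolding cc_weights_def using norm[of ys] pos \<open>s > 0\<close> by (auto simp: s_def 2 p)
      then have "cc (?n ys) = cc (?n zs @ [(a / s + b / s,
          cc [((a / s) / (a / s + b / s), u), ((b / s) / (a / s + b / s), v)])])"
        unfolding eq by (rule cc_assoc)
      moreover have "(a / s) / (a / s + b / s) = a / (a + b)" "(b / s) / (a / s + b / s) = b / (a + b)"
        using \<open>s > 0\<close> pos by (simp_all add: field_simps)
      ultimately show ?thesis
        by (simp only: w_def) (simp add: add_divide_distrib)
    qed
    finally show ?thesis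
      by (simp add: s_def)
  qed
qed

lemma mix_commute:
  assumes "t \<in> {0<..<1}"
  shows "mix t x y = mix (1 - t) y x"
  unfolding mix_def by (rule cc_mset_cong) (use assms in \<open>auto simp: cc_weights_def\<close>)

lemma mix_dist:
  assumes "t \<in> {0<..<1}"
  shows "dist (mix t x y) (mix t x' y') \<le> t * dist x x' + (1 - t) * dist y y'"
  unfolding mix_def using cc_dist[OF assms] .

text \<open>\<open>cc_assoc\<close> acts at the end of a list, so \<open>z\<close> is rotated to the
  front, and \<open>mix_commute\<close> turns the result back.\<close>

lemma mix_mix_left:
  assumes "s \<in> {0<..<1}" "t \<in> {0<..<1}"
  shows "mix s (mix t x y) z = cc [(s * t, x), (s * (1 - t), y), (1 - s, z)]"
proof -
  have w: "cc_weights [(s * t, x), (s * (1 - t), y), (1 - s, z)]"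
    using assms by (auto simp: cc_weights_def algebra_simps)
  have "cc [(s * t, x), (s * (1 - t), y), (1 - s, z)]
      = cc ([(1 - s, z)] @ [(s * t, x), (s * (1 - t), y)])"
    by (rule cc_mset_cong) (use w in \<open>auto simp: cc_weights_def\<close>)
  also have "\<dots> = cc ([(1 - s, z)] @ [(s * t + s * (1 - t),
      cc [(s * t / (s * t + s * (1 - t)), x), (s * (1 - t) / (s * t + s * (1 - t)), y)])])"
    by (rule cc_assoc) (use w in \<open>auto simp: cc_weights_def\<close>)
  also have "s * t + s * (1 - t) = s"
    by (simp add: algebra_simps)
  also have "cc ([(1 - s, z)] @ [(s, cc [(s * t / s, x), (s * (1 - t) / s, y)])]) = mix (1 - s) z (mix t x y)"
    using assms by (simp add: mix_def)
  finally show ?thesis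
    using mix_commute[OF assms(1)] by simp
qed

lemma mix_mix_both:
  assumes "s \<in> {0<..<1}" "t \<in> {0<..<1}" "r \<in> {0<..<1}"
  shows "mix s (mix t x y) (mix r z w) =
    cc [(s * t, x), (s * (1 - t), y), ((1 - s) * r, z), ((1 - s) * (1 - r), w)]"
proof -
  have "s * t + (s * (1 - t) + ((1 - s) * r + (1 - s) * (1 - r))) = 1"
    by (simp add: algebra_simps)
  then have wt: "cc_weights [(s * t, x), (s * (1 - t), y), ((1 - s) * r, z), ((1 - s) * (1 - r), w)]"
    using assms by (auto simp: cc_weights_def)
  have "(1 - s) * r + (1 - s) * (1 - r) = 1 - s"
    by (simp add: algebra_simps)
  then have "cc ([(s * t, x), (s * (1 - t), y)] @ [((1 - s) * r, z), ((1 - s) * (1 - r), w)])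
    = cc ([(s * t, x), (s * (1 - t), y)] @ [(1 - s, mix r z w)])"
    using cc_assoc[of "[(s * t, x), (s * (1 - t), y)]" "(1 - s) * r" z "(1 - s) * (1 - r)" w] wt assms
    by (simp add: mix_def)
  then show ?thesis
    using mix_mix_left[OF assms(1,2)] by simp
qed

text \<open>Both sides expand to the same four weighted points, with the two middle ones
  interchanged.\<close>

lemma mix_medial:
  assumes "s \<in> {0<..<1}" "t \<in> {0<..<1}"
  shows "mix s (mix t x y) (mix t z w) = mix t (mix s x z) (mix s y w)"
proof -
  have "t * s + (t * (1 - s) + ((1 - t) * s + (1 - t) * (1 - s))) = 1"
    by (simp add: algebra_simps)
  then show ?thesis
    unfolding mix_mix_both[OF assms assms(2)] mix_mix_both[OF assms(2,1,1)]
    by (intro cc_mset_cong) (use assms in \<open>auto simp: cc_weights_def mult.commute\<close>)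
qed

text \<open>Makes \<open>y\<close> the outermost point, so that a function affine at
  \<open>y\<close> can be evaluated. The weight of \<open>y\<close> is \<open>s * (1 - t)\<close>;
  the remaining weight is shared by \<open>x\<close> and \<open>z\<close> in the ratio
  \<open>s * t\<close> to \<open>1 - s\<close>.\<close>

lemma mix_mix_exchange:
  assumes "s \<in> {0<..<1}" "t \<in> {0<..<1}"
  shows "mix s (mix t x y) z = mix (1 - s * (1 - t)) (mix (s * t / (1 - s * (1 - t))) x z) y"
proof -
  define r where "r = 1 - s * (1 - t)"
  have "s * (1 - t) < 1 * 1"
    using assms by (intro mult_strict_mono) auto
  then have r: "r \<in> {0<..<1}"
    using assms by (auto simp: r_def)
  have q: "s * t / r \<in> {0<..<1}"
    using assms r by (auto simp: divide_simps r_def algebra_simps)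
  have e: "r * (s * t / r) = s * t" "r * (1 - s * t / r) = 1 - s" "1 - r = s * (1 - t)"
    using r by (auto simp: field_simps r_def)
  show ?thesis
    unfolding r_def[symmetric] mix_mix_left[OF assms] mix_mix_left[OF r q] e
    by (rule cc_mset_cong) (use assms in \<open>auto simp: cc_weights_def algebra_simps\<close>)
qed

section \<open>Averages of copies of one point\<close>

abbreviation "average u n \<equiv> cc (replicate (Suc n) (1 / real (Suc n), u))"

text \<open>The average of index \<open>n\<close> has \<open>n + 1\<close> entries, so blocks of
  indices \<open>k\<close> and \<open>l\<close> make one of index \<open>k + l + 1\<close>. Contract
  the second block by \<open>cc_append\<close>, swap, and contract the other; a normalised block is
  itself an average.\<close>

lemma average_split:
  "average u (k + l + 1) = mix (real (Suc k) / real (k + l + 2)) (average u k) (average u l)"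
proof -
  define N where "N = real (k + l + 2)"
  have N: "N > 0" "real (Suc k) + real (Suc l) = N"
    by (auto simp: N_def)
  let ?p = "(1 / N, u)"
  let ?A = "replicate (Suc k) ?p" and ?B = "replicate (Suc l) ?p"
  have avg: "map (\<lambda>(a, u). (a / (real (Suc n) / N), u)) (replicate (Suc n) ?p)
      = replicate (Suc n) (1 / real (Suc n), u)" for n
    using N by (simp add: map_replicate del: replicate_Suc of_nat_Suc)
  have sum: "sum_list (map fst (replicate (Suc n) ?p)) = real (Suc n) / N" for n
    by (simp add: sum_list_replicate del: replicate_Suc of_nat_Suc)
  have split: "real (Suc k) / N + real (Suc l) / N = 1"
    using N by (simp only: add_divide_distrib[symmetric]) simp
  have wts: "cc_weights (?A @ ?B)"
    unfolding cc_weights_def map_append sum_list_append sum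
    using split N by (auto simp: set_replicate_conv_if simp del: replicate_Suc)
  have "cc (?A @ ?B) = cc (?A @ [(real (Suc l) / N, average u l)])"
    using cc_append[OF wts] unfolding sum avg by simp
  also have "\<dots> = cc ([(real (Suc l) / N, average u l)] @ ?A)"
    by (rule cc_mset_cong)
       (use split N in \<open>auto simp: cc_weights_def sum_list_replicate add.commute simp del: replicate_Suc\<close>)
  also have "\<dots> = cc ([(real (Suc l) / N, average u l)] @ [(real (Suc k) / N, average u k)])"
  proof -
    have "cc_weights ([(real (Suc l) / N, average u l)] @ ?A)"
      unfolding cc_weights_def map_append sum_list_append sum
      using split N by (auto simp: set_replicate_conv_if simp del: replicate_Suc)
    then show ?thesis
      using cc_append[of "[(real (Suc l) / N, average u l)]" ?A] unfolding sum avg by simp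
  qed
  also have "\<dots> = mix (real (Suc l) / N) (average u l) (average u k)"
  proof -
    have "real (Suc k) / N = 1 - real (Suc l) / N"
      using split by linarith
    then show ?thesis
      by (simp only: mix_def append_Cons append_Nil)
  qed
  also have "\<dots> = mix (real (Suc k) / N) (average u k) (average u l)"
    using split N by (subst mix_commute) (auto simp: divide_simps algebra_simps)
  also have "?A @ ?B = replicate (Suc (k + l + 1)) ?p"
    by (simp only: replicate_add[symmetric]) simp
  finally show ?thesis
    by (simp add: N_def algebra_simps)
qed

text \<open>The average of \<open>n + 2\<close> copies of \<open>u\<close> is a mixture of two averages with weight
  \<open>l n \<longlonglongrightarrow> t\<close>; let \<open>n\<close> tend to infinity.\<close>

lemma mix_convexification:
  fixes u :: 'a
  assumes t: "t \<in> {0<..<1}"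
  defines "x \<equiv> convexification cc u"
  shows "mix t x x = x"
proof -
  have lim: "average u \<longlonglongrightarrow> x"
    using cc_convexification_exists[of u]
    unfolding x_def convexification_def by (simp add: convergent_LIMSEQ_iff)
  \<comment> \<open>Of \<open>n + 2\<close> copies, \<open>k n + 1\<close> go to the first average
    and \<open>n - k n + 1\<close> to the second. The share of the first tends to \<open>t\<close>,
    and both blocks grow without bound because \<open>t\<close> is neither 0 nor 1.\<close>
  define k where "k n = nat \<lfloor>t * real n\<rfloor>" for n
  have k_le: "k n \<le> n" for n
  proof -
    have "t * real n \<le> 1 * real n"
      using t by (intro mult_right_mono) auto
    then show ?thesis
      by (simp add: k_def nat_le_iff floor_le_iff)
  qed
  have k_bounds: "t * real n - 1 \<le> real (k n)" "real (k n) \<le> t * real n" for n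
    using t by (auto simp: k_def)
  define l where "l n = real (Suc (k n)) / real (k n + (n - k n) + 2)" for n
  have l_eq: "l n = (real (k n) + 1) / (real n + 2)" for n
    using k_le[of n] by (simp add: l_def add.commute)
  have l01: "l n \<in> {0<..<1}" for n
    using k_le[of n] by (auto simp: l_eq divide_simps)
  have l_lim: "l \<longlonglongrightarrow> t"
  proof (rule tendsto_sandwich)
    show "\<forall>\<^sub>F n in sequentially. t * real n / (real n + 2) \<le> l n"
      using k_bounds by (intro always_eventually) (auto simp: l_eq intro!: divide_right_mono simp: algebra_simps)
    show "\<forall>\<^sub>F n in sequentially. l n \<le> (t * real n + 1) / (real n + 2)"
      using k_bounds by (intro always_eventually) (auto simp: l_eq intro!: divide_right_mono)
    show "(\<lambda>n. t * real n / (real n + 2)) \<longlonglongrightarrow> t" "(\<lambda>n. (t * real n + 1) / (real n + 2)) \<longlonglongrightarrow> t"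
      by real_asymp+
  qed
  have k_inf: "filterlim k at_top sequentially"
  proof -
    have "filterlim (\<lambda>n. t * real n - 1) at_top sequentially"
      using t by real_asymp
    then have "filterlim (\<lambda>n. real (k n)) at_top sequentially"
      by (rule filterlim_at_top_mono) (use k_bounds in auto)
    then show ?thesis
      by (simp add: filterlim_sequentially_iff_filterlim_real)
  qed
  have nk_inf: "filterlim (\<lambda>n. n - k n) at_top sequentially"
  proof -
    have "filterlim (\<lambda>n. (1 - t) * real n) at_top sequentially"
      using t by real_asymp
    then have "filterlim (\<lambda>n. real (n - k n)) at_top sequentially"
      by (rule filterlim_at_top_mono)
         (use k_bounds k_le in \<open>auto simp: of_nat_diff algebra_simps\<close>)
    then show ?thesis
      by (simp add: filterlim_sequentially_iff_filterlim_real)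
  qed
  have avg: "average u (n + 1) = mix (l n) (average u (k n)) (average u (n - k n))" for n
    using average_split[where u = u and k = "k n" and l = "n - k n"] k_le[of n] unfolding l_def by simp
  \<comment> \<open>The same sequence has two limits: one by continuity in the weights, the other
    because it stays close to \<open>average u (n + 1)\<close>, which converges to
    \<open>x\<close>.\<close>
  have "(\<lambda>n. mix (l n) x x) \<longlonglongrightarrow> mix t x x"
    unfolding mix_def by (intro cc_weight_continuous l01 t l_lim)
  moreover have "(\<lambda>n. mix (l n) x x) \<longlonglongrightarrow> x"
  proof -
    have "(\<lambda>n. dist (average u (k n)) x) \<longlonglongrightarrow> 0" "(\<lambda>n. dist (average u (n - k n)) x) \<longlonglongrightarrow> 0"
      using filterlim_compose[OF lim k_inf] filterlim_compose[OF lim nk_inf]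
      by (simp_all only: tendsto_dist_iff[symmetric])
    then have bound: "(\<lambda>n. dist (average u (k n)) x + dist (average u (n - k n)) x) \<longlonglongrightarrow> 0"
      by (auto intro: tendsto_add_zero)
    have "dist (mix (l n) x x) (average u (n + 1))
        \<le> dist (average u (k n)) x + dist (average u (n - k n)) x" for n
    proof -
      have "dist (mix (l n) x x) (average u (n + 1))
          \<le> l n * dist x (average u (k n)) + (1 - l n) * dist x (average u (n - k n))"
        unfolding avg by (rule mix_dist[OF l01])
      also have "\<dots> \<le> 1 * dist x (average u (k n)) + 1 * dist x (average u (n - k n))"
        using l01[of n] by (intro add_mono mult_right_mono) auto
      finally show ?thesis
        by (simp add: dist_commute)
    qed
    then have near: "(\<lambda>n. dist (mix (l n) x x) (average u (n + 1))) \<longlonglongrightarrow> 0"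
      by (intro tendsto_sandwich[OF _ _ tendsto_const bound] always_eventually) auto
    have "(\<lambda>n. dist (average u (n + 1)) x) \<longlonglongrightarrow> 0"
      using LIMSEQ_ignore_initial_segment[OF lim, of 1] by (simp only: tendsto_dist_iff[symmetric])
    from tendsto_add_zero[OF near this] have "(\<lambda>n. dist (mix (l n) x x) x) \<longlonglongrightarrow> 0"
      by (rule tendsto_sandwich[OF _ _ tendsto_const, rotated 2])
         (intro always_eventually allI zero_le_dist dist_triangle)+
    then show ?thesis
      by (simp only: tendsto_dist_iff[symmetric])
  qed
  ultimately show ?thesis
    by (rule LIMSEQ_unique)
qed

end

section \<open>Idempotence in convexifiable spaces\<close>

locale convexifiable_cc_space = cc_space +
  assumes convexifiable: "cc_convexifiable cc"
begin

lemma mix_idem [simp]: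
  assumes "t \<in> {0<..<1}"
  shows "mix t x x = x"
proof -
  obtain u where "x = convexification cc u"
    using convexifiable unfolding cc_convexifiable_def by (metis UNIV_I image_iff)
  then show ?thesis
    using mix_convexification[OF assms] by simp
qed

text \<open>Splitting off one copy at a time, \<open>mix_idem\<close> shows that every average of
  copies of \<open>x\<close> is already \<open>x\<close>, so the limit is taken of a constant
  sequence.\<close>

lemma convexification_eq [simp]: "convexification cc x = x"
proof -
  have "average x n = x" for n
  proof (induction n)
    case 0
    then show ?case by (simp add: cc_single)
  next
    case (Suc n)
    have "average x (Suc n) = mix (real (Suc n) / real (n + 2)) (average x n) (average x 0)"
      using average_split[where u = x and k = n and l = 0] by simp
    also have "\<dots> = x"
      unfolding Suc by (simp add: cc_single)
    finally show ?case .
  qed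
  then show ?thesis
    unfolding convexification_def by (simp only: lim_const)
qed

text \<open>Expanded to three entries, the last two both sit at \<open>y\<close> and merge by
  idempotence.\<close>

lemma mix_mix_same:
  assumes "s \<in> {0<..<1}" "t \<in> {0<..<1}"
  shows "mix s (mix t x y) y = mix (s * t) x y"
proof -
  have "s * t < 1 * 1"
    using assms by (intro mult_strict_mono) auto
  then have st: "s * t \<in> {0<..<1}"
    using assms by auto
  \<comment> \<open>The share of the inner copy of \<open>y\<close> in the total weight
    \<open>1 - s * t\<close> of \<open>y\<close>.\<close>
  define r where "r = s * (1 - t) / (1 - s * t)"
  have r: "r \<in> {0<..<1}"
    using st assms by (auto simp: r_def divide_simps algebra_simps)
  have e: "(1 - s * t) * r = s * (1 - t)" "(1 - s * t) * (1 - r) = 1 - s"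
    using st by (auto simp: r_def field_simps)
  have w: "cc_weights [(s * t, x), (s * (1 - t), y), (1 - s, y)]"
    using assms by (auto simp: cc_weights_def algebra_simps)
  have sum: "s * (1 - t) + (1 - s) = 1 - s * t"
    by (simp add: algebra_simps)
  have quot: "s * (1 - t) / (1 - s * t) = r" "(1 - s) / (1 - s * t) = 1 - r"
    using st by (auto simp: r_def field_simps)
  have "cc ([(s * t, x)] @ [(s * (1 - t), y), (1 - s, y)]) = mix (s * t) x (mix r y y)"
    using cc_assoc[of "[(s * t, x)]" "s * (1 - t)" y "1 - s" y] w
    unfolding sum quot by (simp add: mix_def)
  then show ?thesis
    using r mix_mix_left[OF assms] by simp
qed

lemma mix_mix_distrib:
  assumes "s \<in> {0<..<1}" "t \<in> {0<..<1}"
  shows "mix s (mix t x y) z = mix t (mix s x z) (mix s y z)"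
  using mix_medial[OF assms, of x y z z] assms by simp

section \<open>Tangents of convex functions and norming functionals\<close>

definition nonexpansive_convex :: "('a \<Rightarrow> real) \<Rightarrow> bool" where
  "nonexpansive_convex h \<longleftrightarrow> (\<forall>x y. h x \<le> h y + dist x y) \<and>
     (\<forall>t\<in>{0<..<1}. \<forall>x y. h (mix t x y) \<le> t * h x + (1 - t) * h y)"

text \<open>The property gained one point at a time by taking tangents; holding at every
  \<open>y\<close>, it is affinity for binary combinations.\<close>

definition affine_at :: "('a \<Rightarrow> real) \<Rightarrow> 'a \<Rightarrow> bool" where
  "affine_at h y \<longleftrightarrow> (\<forall>t\<in>{0<..<1}. \<forall>x. h (mix t x y) = t * h x + (1 - t) * h y)"

text \<open>Equals \<open>h z\<close> plus the difference quotient
  \<open>(h (mix s x z) - h z) / s\<close>: the chord from \<open>z\<close> through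
  \<open>mix s x z\<close>, extrapolated to \<open>x\<close>.\<close>

definition slope :: "('a \<Rightarrow> real) \<Rightarrow> 'a \<Rightarrow> 'a \<Rightarrow> real \<Rightarrow> real" where
  "slope h z x s = (h (mix s x z) - (1 - s) * h z) / s"

text \<open>For convex \<open>h\<close> the slope is nondecreasing in \<open>s\<close>
  (\<open>slope_mono\<close>), so the infimum is the limit as \<open>s\<close> tends to 0, namely
  \<open>h z\<close> plus the one-sided derivative of \<open>h\<close> at \<open>z\<close> towards
  \<open>x\<close>.\<close>

definition tangent :: "('a \<Rightarrow> real) \<Rightarrow> 'a \<Rightarrow> 'a \<Rightarrow> real" where
  "tangent h z x = (INF s\<in>{0<..<1}. slope h z x s)"

text \<open>Convexity comes from \<open>cc_dist\<close> after reading \<open>v\<close> as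
  \<open>mix t v v\<close>.\<close>

lemma nonexpansive_convex_dist: "nonexpansive_convex (\<lambda>x. dist x v)"
  unfolding nonexpansive_convex_def
proof (intro conjI ballI allI)
  show "dist x v \<le> dist y v + dist x y" for x y
    using dist_triangle[of x v y] by simp
  show "dist (mix t x y) v \<le> t * dist x v + (1 - t) * dist y v" if "t \<in> {0<..<1}" for t x y
    using mix_dist[OF that, of x y v v] that by simp
qed

context
  fixes h :: "'a \<Rightarrow> real" and z :: 'a
  assumes h: "nonexpansive_convex h"
begin

text \<open>Mixing with \<open>z\<close> contracts distances by the factor \<open>s\<close>, which
  cancels the division by \<open>s\<close>.\<close>

lemma slope_Lipschitz:
  assumes "s \<in> {0<..<1}"
  shows "slope h z x s \<le> slope h z y s + dist x y"
proof -
  have "h (mix s x z) \<le> h (mix s y z) + dist (mix s x z) (mix s y z)"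
    using h by (simp add: nonexpansive_convex_def)
  also have "\<dots> \<le> h (mix s y z) + s * dist x y"
    using mix_dist[OF assms, of x z y z] by simp
  finally have "slope h z x s \<le> (h (mix s y z) + s * dist x y - (1 - s) * h z) / s"
    using assms by (auto simp: slope_def intro!: divide_right_mono)
  also have "\<dots> = slope h z y s + dist x y"
    using assms by (simp add: slope_def add_divide_distrib diff_divide_distrib)
  finally show ?thesis .
qed

lemma slope_self:
  assumes "s \<in> {0<..<1}"
  shows "slope h z z s = h z"
  using assms by (simp add: slope_def field_simps)

lemma slope_lower:
  assumes "s \<in> {0<..<1}"
  shows "h z - dist x z \<le> slope h z x s"
  using slope_Lipschitz[OF assms, of z x] slope_self[OF assms] by (simp add: dist_commute)

lemma slope_upper:
  assumes "s \<in> {0<..<1}"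
  shows "slope h z x s \<le> h x"
proof -
  have "h (mix s x z) \<le> s * h x + (1 - s) * h z"
    using h assms by (simp add: nonexpansive_convex_def)
  then show ?thesis
    using assms by (simp add: slope_def field_simps)
qed

text \<open>The chord towards \<open>mix t x z\<close> at parameter \<open>s\<close> is the chord
  towards \<open>x\<close> at parameter \<open>s * t\<close>; this yields homogeneity of the tangent
  about \<open>z\<close>.\<close>

lemma slope_mult:
  assumes "s \<in> {0<..<1}" "t \<in> {0<..<1}"
  shows "slope h z (mix t x z) s = t * slope h z x (s * t) + (1 - t) * h z"
  using assms unfolding slope_def mix_mix_same[OF assms] by (simp add: field_simps)

text \<open>Monotone difference quotients of a convex function: \<open>mix s x z\<close> lies
  between \<open>mix r x z\<close> and \<open>z\<close>, with weight \<open>s / r\<close> on the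
  former.\<close>

lemma slope_mono:
  assumes "s \<in> {0<..<1}" "r \<in> {0<..<1}" "s \<le> r"
  shows "slope h z x s \<le> slope h z x r"
proof (cases "s = r")
  case False
  define t where "t = s / r"
  have t: "t \<in> {0<..<1}" "s = t * r"
    using assms False by (auto simp: t_def)
  have "h (mix s x z) \<le> t * h (mix r x z) + (1 - t) * h z"
    using h t assms mix_mix_same[OF t(1) assms(2), of x z] by (metis nonexpansive_convex_def)
  then have "h (mix s x z) - (1 - s) * h z \<le> t * (h (mix r x z) - (1 - r) * h z)"
    unfolding t(2) by (simp add: algebra_simps)
  then show ?thesis
    using assms t by (simp add: slope_def divide_simps) (simp add: algebra_simps)
qed simp

lemma slope_bdd_below: "bdd_below (slope h z x ` {0<..<1})"
  using slope_lower by (meson bdd_belowI2)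

lemma tangent_le_slope:
  assumes "s \<in> {0<..<1}"
  shows "tangent h z x \<le> slope h z x s"
  unfolding tangent_def by (rule cINF_lower[OF slope_bdd_below assms])

lemma tangent_greatest:
  assumes "\<And>s. s \<in> {0<..<1} \<Longrightarrow> c \<le> slope h z x s"
  shows "c \<le> tangent h z x"
  unfolding tangent_def by (rule cINF_greatest) (use assms in auto)

lemma tangent_le: "tangent h z x \<le> h x"
  using tangent_le_slope[of "1/2" x] slope_upper[of "1/2" x] by simp

lemma tangent_self: "tangent h z z = h z"
  using slope_self tangent_greatest tangent_le by (intro antisym) auto

lemma tangent_less:
  assumes "tangent h z x < c"
  obtains s where "s \<in> {0<..<1}" "slope h z x s < c"
  using assms tangent_greatest[of c x] by (meson not_le)

lemma nonexpansive_convex_tangent: "nonexpansive_convex (tangent h z)"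
  unfolding nonexpansive_convex_def
proof (intro conjI ballI allI)
  fix x y
  have "tangent h z x - dist x y \<le> tangent h z y"
    by (rule tangent_greatest)
       (use tangent_le_slope[of _ x] slope_Lipschitz[of _ x y] in \<open>smt (verit)\<close>)
  then show "tangent h z x \<le> tangent h z y + dist x y"
    by simp
next
  fix t :: real and x y
  assume t: "t \<in> {0<..<1}"
  show "tangent h z (mix t x y) \<le> t * tangent h z x + (1 - t) * tangent h z y"
  proof (rule field_le_epsilon)
    fix e :: real
    assume "e > 0"
    obtain r where r: "r \<in> {0<..<1}" "slope h z x r < tangent h z x + e"
      using tangent_less[of x "tangent h z x + e"] \<open>e > 0\<close> by auto
    obtain q where q: "q \<in> {0<..<1}" "slope h z y q < tangent h z y + e"
      using tangent_less[of y "tangent h z y + e"] \<open>e > 0\<close> by auto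
    \<comment> \<open>By monotonicity the smaller parameter is nearly optimal for both
      \<open>x\<close> and \<open>y\<close>, and at one common parameter the slope is convex in its
      end point.\<close>
    define s where "s = min r q"
    have s: "s \<in> {0<..<1}"
      using r q by (auto simp: s_def)
    have "h (mix s (mix t x y) z) \<le> t * h (mix s x z) + (1 - t) * h (mix s y z)"
      unfolding mix_mix_distrib[OF s t] using h t by (simp add: nonexpansive_convex_def)
    then have "slope h z (mix t x y) s \<le> t * slope h z x s + (1 - t) * slope h z y s"
      using s by (simp add: slope_def divide_simps) (simp add: algebra_simps)
    also have "\<dots> \<le> t * slope h z x r + (1 - t) * slope h z y q"
      using t s r q by (intro add_mono mult_left_mono slope_mono) (auto simp: s_def)
    also have "\<dots> \<le> t * (tangent h z x + e) + (1 - t) * (tangent h z y + e)"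
      using t r q by (intro add_mono mult_left_mono) auto
    finally show "tangent h z (mix t x y) \<le> t * tangent h z x + (1 - t) * tangent h z y + e"
      using tangent_le_slope[OF s, of "mix t x y"] by (simp add: algebra_simps)
  qed
qed

text \<open>By \<open>slope_mult\<close> the slopes towards \<open>mix t x z\<close> are those
  towards \<open>x\<close> at the parameters \<open>s * t\<close>. Restricting the infimum to these
  small parameters does not change it, since slopes decrease as the parameter does.\<close>

lemma affine_at_tangent_self: "affine_at (tangent h z) z"
  unfolding affine_at_def tangent_self
proof (intro ballI allI)
  fix t :: real and x
  assume t: "t \<in> {0<..<1}"
  show "tangent h z (mix t x z) = t * tangent h z x + (1 - t) * h z"
  proof (rule antisym)
    have "(tangent h z (mix t x z) - (1 - t) * h z) / t \<le> tangent h z x"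
    proof (rule tangent_greatest)
      fix s :: real
      assume s: "s \<in> {0<..<1}"
      have "s * t < 1 * 1"
        using s t by (intro mult_strict_mono) auto
      then have "slope h z x (s * t) \<le> slope h z x s"
        using s t by (intro slope_mono) auto
      moreover have "tangent h z (mix t x z) \<le> t * slope h z x (s * t) + (1 - t) * h z"
        using tangent_le_slope[OF s] slope_mult[OF s t] by metis
      ultimately show "(tangent h z (mix t x z) - (1 - t) * h z) / t \<le> slope h z x s"
        using t by (simp add: field_simps) (smt (verit) mult_left_mono)
    qed
    then show "tangent h z (mix t x z) \<le> t * tangent h z x + (1 - t) * h z"
      using t by (simp add: field_simps)
  next
    show "t * tangent h z x + (1 - t) * h z \<le> tangent h z (mix t x z)"
    proof (rule tangent_greatest)
      fix s :: real
      assume s: "s \<in> {0<..<1}"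
      have "s * t < 1 * 1"
        using s t by (intro mult_strict_mono) auto
      then have "tangent h z x \<le> slope h z x (s * t)"
        using s t by (intro tangent_le_slope) auto
      then show "t * tangent h z x + (1 - t) * h z \<le> slope h z (mix t x z) s"
        unfolding slope_mult[OF s t] using t by simp
    qed
  qed
qed

text \<open>Both sides compare \<open>h\<close> on the triangle \<open>x, y, z\<close>; the substitution
  \<open>s \<mapsto> s t / (1 - s (1 - t))\<close> is a bijection of \<open>(0, 1)\<close>.\<close>

lemma tangent_affine_at:
  assumes y: "affine_at h y"
  shows "affine_at (tangent h z) y" and "tangent h z y = h y"
proof -
  show ty: "tangent h z y = h y"
  proof (rule antisym[OF tangent_le tangent_greatest])
    \<comment> \<open>Affinity at \<open>y\<close> makes \<open>h\<close> linear on the segment from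
      \<open>z\<close> to \<open>y\<close>, so every slope towards \<open>y\<close> equals
      \<open>h y\<close>.\<close>
    fix s :: real
    assume s: "s \<in> {0<..<1}"
    then have "h (mix s y z) = (1 - s) * h z + s * h y"
      using y mix_commute[OF s, of y z] by (simp add: affine_at_def)
    then show "h y \<le> slope h z y s"
      using s by (simp add: slope_def)
  qed
  show "affine_at (tangent h z) y"
    unfolding affine_at_def ty
  proof (intro ballI allI)
    fix t :: real and x
    assume t: "t \<in> {0<..<1}"
    define \<mu> where "\<mu> s = s * t / (1 - s * (1 - t))" for s
    have pos: "s * (1 - t) \<in> {0<..<1}" if "s \<in> {0<..<1}" for s
    proof -
      have "s * (1 - t) < 1 * 1"
        using that t by (intro mult_strict_mono) auto
      then show ?thesis
        using that t by auto
    qed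
    have \<mu>: "\<mu> s \<in> {0<..<1}" if "s \<in> {0<..<1}" for s
      using pos[OF that] that t by (auto simp: \<mu>_def divide_simps algebra_simps)
    \<comment> \<open>With \<open>y\<close> moved outermost, affinity of \<open>h\<close> at
      \<open>y\<close> splits off its contribution; what remains is a slope towards \<open>x\<close>
      at the parameter \<open>\<mu> s\<close>.\<close>
    have slope: "slope h z (mix t x y) s = t * slope h z x (\<mu> s) + (1 - t) * h y"
      if s: "s \<in> {0<..<1}" for s
    proof -
      define r where "r = 1 - s * (1 - t)"
      have r: "r \<in> {0<..<1}" "r > 0"
        using pos[OF s] by (auto simp: r_def)
      have m: "\<mu> s = s * t / r"
        by (simp add: \<mu>_def r_def)
      have eq: "h (mix s (mix t x y) z) = r * h (mix (\<mu> s) x z) + (1 - r) * h y"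
        unfolding mix_mix_exchange[OF s t] m r_def[symmetric]
        using y r by (simp add: affine_at_def)
      have s': "1 - s = r * (1 - \<mu> s)"
        using r by (simp add: m field_simps) (simp add: r_def algebra_simps)
      have quot: "r / s = t / \<mu> s" "(1 - r) / s = 1 - t"
        using r s t by (simp_all add: m) (simp add: r_def)
      have "slope h z (mix t x y) s
          = (r * (h (mix (\<mu> s) x z) - (1 - \<mu> s) * h z) + (1 - r) * h y) / s"
      proof -
        have "r * A + (1 - r) * B - r * (1 - \<mu> s) * C = r * (A - (1 - \<mu> s) * C) + (1 - r) * B" for A B C
          by (simp add: algebra_simps)
        then show ?thesis
          unfolding slope_def eq s' by simp
      qed
      also have "\<dots> = (r / s) * (h (mix (\<mu> s) x z) - (1 - \<mu> s) * h z) + ((1 - r) / s) * h y"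
        by (simp add: add_divide_distrib)
      finally show ?thesis
        unfolding quot by (simp add: slope_def)
    qed
    show "tangent h z (mix t x y) = t * tangent h z x + (1 - t) * h y"
    proof (rule antisym)
      have "(tangent h z (mix t x y) - (1 - t) * h y) / t \<le> tangent h z x"
      proof (rule tangent_greatest)
        fix q :: real
        assume q: "q \<in> {0<..<1}"
        \<comment> \<open>The preimage of \<open>q\<close> under \<open>\<mu>\<close>.\<close>
        define s where "s = q / (t + q * (1 - t))"
        have d: "t + q * (1 - t) > 0"
          using q t by (intro add_pos_pos) auto
        have s: "s \<in> {0<..<1}"
          using q t d by (auto simp: s_def divide_simps) (simp add: algebra_simps)
        have "1 - s * (1 - t) = t / (t + q * (1 - t))"
          using d by (simp add: s_def field_simps)
        then have "\<mu> s = q"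
          using d t by (simp add: \<mu>_def s_def)
        then have "tangent h z (mix t x y) \<le> t * slope h z x q + (1 - t) * h y"
          using tangent_le_slope[OF s] slope[OF s] by metis
        then show "(tangent h z (mix t x y) - (1 - t) * h y) / t \<le> slope h z x q"
          using t by (simp add: field_simps)
      qed
      then show "tangent h z (mix t x y) \<le> t * tangent h z x + (1 - t) * h y"
        using t by (simp add: field_simps)
    next
      show "t * tangent h z x + (1 - t) * h y \<le> tangent h z (mix t x y)"
      proof (rule tangent_greatest)
        fix s :: real
        assume s: "s \<in> {0<..<1}"
        show "t * tangent h z x + (1 - t) * h y \<le> slope h z (mix t x y) s"
          unfolding slope[OF s] using t tangent_le_slope[OF \<mu>[OF s], of x] by simp
      qed
    qed
  qed
qed

end

section \<open>Continuous affine functions\<close>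

lemma cc_affine_sum:
  assumes "\<And>t x y. t \<in> {0<..<1} \<Longrightarrow> f (mix t x y) = t * f x + (1 - t) * f y"
    and "cc_weights xs"
  shows "f (cc xs) = (\<Sum>p\<leftarrow>xs. fst p * f (snd p))"
  using assms(2)
proof (induction "length xs" arbitrary: xs rule: less_induct)
  case less
  have "xs \<noteq> []"
    using less.prems by (auto simp: cc_weights_def)
  then consider p where "xs = [p]" | zs p q where "xs = zs @ [p, q]"
    by (metis append.assoc append_Cons append_Nil rev_exhaust)
  then show ?case
  proof cases
    case (1 p)
    then show ?thesis
      using less.prems by (cases p) (simp add: cc_weights_def cc_single)
  next
    case (2 zs p q)
    obtain a u b v where p: "p = (a, u)" "q = (b, v)"
      by (cases p, cases q) auto
    have pos: "a > 0" "b > 0"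
      using less.prems 2 p by (auto simp: cc_weights_def)
    define t where "t = a / (a + b)"
    have t: "t \<in> {0<..<1}" "b / (a + b) = 1 - t" "(a + b) * t = a" "(a + b) * (1 - t) = b"
      using pos by (auto simp: t_def field_simps)
    \<comment> \<open>Merging the last two entries shortens the list; binary affinity then
      distributes the merged term.\<close>
    have "cc_weights (zs @ [(a + b, mix t u v)])"
      using less.prems pos by (auto simp: cc_weights_def 2 p add.assoc)
    then have "f (cc (zs @ [(a + b, mix t u v)])) = (\<Sum>p\<leftarrow>zs @ [(a + b, mix t u v)]. fst p * f (snd p))"
      by (intro less.hyps) (auto simp: 2)
    also have "(a + b) * f (mix t u v) = ((a + b) * t) * f u + ((a + b) * (1 - t)) * f v"
      by (simp only: assms(1)[OF t(1)] distrib_left mult.assoc)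
    then have "(\<Sum>p\<leftarrow>zs @ [(a + b, mix t u v)]. fst p * f (snd p)) = (\<Sum>p\<leftarrow>xs. fst p * f (snd p))"
      unfolding t(3,4) by (simp add: 2 p)
    finally show ?thesis
      using cc_assoc[of zs a u b v] less.prems t(2) by (simp add: 2 p mix_def t_def)
  qed
qed

lemma cc_dual_mix:
  assumes "f \<in> cc_dual cc" "t \<in> {0<..<1}"
  shows "f (mix t x y) = t * f x + (1 - t) * f y"
proof -
  have "f (cc xs) = (\<Sum>p\<leftarrow>xs. fst p * f (snd p))"
    if "\<forall>p\<in>set xs. fst p \<in> {0<..<1}" "sum_list (map fst xs) = 1" for xs
  proof -
    have "- f (cc xs) \<le> (\<Sum>p\<leftarrow>xs. fst p * - f (snd p))" "f (cc xs) \<le> (\<Sum>p\<leftarrow>xs. fst p * f (snd p))"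
      using that assms(1) by (auto simp: cc_dual_def cc_affine_def cc_convex_def)
    moreover have "(\<Sum>p\<leftarrow>xs. fst p * - f (snd p)) = - (\<Sum>p\<leftarrow>xs. fst p * f (snd p))"
      by (induction xs) auto
    ultimately show ?thesis
      by linarith
  qed
  from this[of "[(t, x), (1 - t, y)]"] show ?thesis
    using assms(2) by (simp add: mix_def)
qed

lemma cc_dualI:
  assumes "\<And>t x y. t \<in> {0<..<1} \<Longrightarrow> f (mix t x y) = t * f x + (1 - t) * f y"
    and "continuous_on UNIV f"
  shows "f \<in> cc_dual cc"
proof -
  have eq: "f (cc xs) = (\<Sum>p\<leftarrow>xs. fst p * f (snd p))"
    if "\<forall>p\<in>set xs. fst p \<in> {0<..<1}" "sum_list (map fst xs) = 1" for xs
    using that by (intro cc_affine_sum assms(1)) (auto simp: cc_weights_def)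
  moreover have "(\<Sum>p\<leftarrow>xs. fst p * - f (snd p)) = - (\<Sum>p\<leftarrow>xs. fst p * f (snd p))" for xs
    by (induction xs) auto
  ultimately show ?thesis
    using assms(2) by (auto simp: cc_dual_def cc_affine_def cc_convex_def)
qed

lemma cc_dual_sum:
  assumes "f \<in> cc_dual cc" "cc_weights xs"
  shows "f (cc xs) = (\<Sum>p\<leftarrow>xs. fst p * f (snd p))"
  using cc_affine_sum cc_dual_mix assms by blast

section \<open>Construction of norming functionals\<close>

primrec tangents :: "(nat \<Rightarrow> 'a) \<Rightarrow> ('a \<Rightarrow> real) \<Rightarrow> nat \<Rightarrow> 'a \<Rightarrow> real" where
  "tangents z h 0 = h"
| "tangents z h (Suc n) = tangent (tangents z h n) (z n)"

text \<open>Used to separate points by \<open>cc_dual cc\<close> and to turn distances of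
  expectations into integrals.\<close>

lemma norming_functional:
  fixes a b :: 'a and w :: "nat \<Rightarrow> 'a"
  assumes dense: "closure (range w) = UNIV"
  obtains f where "f \<in> cc_dual cc" "\<And>x y. f x \<le> f y + dist x y" "f a - f b = dist a b"
proof -
  define z where "z n = (case n of 0 \<Rightarrow> a | Suc k \<Rightarrow> w k)" for n
  define H where "H = tangents z (\<lambda>x. dist x b)"
  have H_0: "H 0 = (\<lambda>x. dist x b)" and H_Suc: "H (Suc n) = tangent (H n) (z n)" for n
    by (simp_all add: H_def)
  have conv: "nonexpansive_convex (H n)" for n
    by (induction n) (auto simp: H_0 H_Suc nonexpansive_convex_dist nonexpansive_convex_tangent)
  have Lip: "H n x \<le> H n y + dist x y" for n x y
    using conv[of n] by (simp add: nonexpansive_convex_def)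
  have aff: "affine_at (H n) (z k)" if "k < n" for k n
    using that
    by (induction n)
       (auto simp: H_Suc less_Suc_eq intro: affine_at_tangent_self tangent_affine_at conv)
  have dec: "decseq (\<lambda>n. H n x)" for x
    by (intro decseq_SucI) (simp add: H_Suc tangent_le conv)
  \<comment> \<open>The first tangent is taken at \<open>a\<close> itself and keeps the value there.
    From then on \<open>H n\<close> is affine at \<open>a\<close>, so no later tangent changes this
    value.\<close>
  have H_a: "H n a = dist a b" for n
  proof (induction n)
    case (Suc n)
    then show ?case
      using tangent_self[OF conv, of n a] tangent_affine_at(2)[OF conv aff[of 0 n]]
      by (cases n) (auto simp: H_Suc z_def)
  qed (simp add: H_0)
  have "\<exists>l. (\<lambda>n. H n x) \<longlonglongrightarrow> l" for x
  \<comment> \<open>The fixed value at \<open>a\<close> and the Lipschitz bound keep the decreasing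
    sequence bounded below.\<close>
  proof -
    have "dist a b - dist a x \<le> H n x" for n
      using Lip[of n a x] by (simp add: H_a)
    then show ?thesis
      using decseq_convergent[OF dec] by metis
  qed
  then obtain f where lim: "\<And>x. (\<lambda>n. H n x) \<longlonglongrightarrow> f x"
    by metis
  have f_Lip: "f x \<le> f y + dist x y" for x y
    by (rule LIMSEQ_le[OF lim tendsto_add[OF lim tendsto_const]]) (use Lip in auto)
  then have f_abs: "\<bar>f x - f y\<bar> \<le> dist x y" for x y
    using f_Lip[of x y] f_Lip[of y x] dist_commute[of x y] by linarith
  have f_cont: "continuous_on UNIV f"
    by (rule continuous_onI) (metis f_abs dist_real_def le_less_trans less_imp_le)
  have f_z: "f (mix t x (z k)) = t * f x + (1 - t) * f (z k)" if "t \<in> {0<..<1}" for t x k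
  proof (rule LIMSEQ_unique[OF lim])
    have "\<forall>\<^sub>F n in sequentially. t * H n x + (1 - t) * H n (z k) = H n (mix t x (z k))"
      using eventually_gt_at_top[of k]
      by eventually_elim (use aff that in \<open>auto simp: affine_at_def\<close>)
    then show "(\<lambda>n. H n (mix t x (z k))) \<longlonglongrightarrow> t * f x + (1 - t) * f (z k)"
      by (rule Lim_transform_eventually[rotated]) (intro tendsto_intros lim)
  qed
  have f_mix: "f (mix t x y) = t * f x + (1 - t) * f y" if t: "t \<in> {0<..<1}" for t x y
  proof -
    \<comment> \<open>Affinity at the points \<open>w k\<close> extends to every \<open>y\<close> by
      density, as \<open>f\<close> and \<open>mix t x\<close> are continuous.\<close>
    have "y \<in> closure (range w)"
      by (simp add: dense)
    then obtain v where v: "\<And>n. v n \<in> range w" "v \<longlonglongrightarrow> y"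
      by (auto simp: closure_sequential)
    have mix: "(\<lambda>n. mix t x (v n)) \<longlonglongrightarrow> mix t x y"
    proof (rule metric_tendsto_imp_tendsto[OF v(2)])
      have "dist (mix t x (v n)) (mix t x y) \<le> 1 * dist (v n) y" for n
      proof -
        have "dist (mix t x (v n)) (mix t x y) \<le> (1 - t) * dist (v n) y"
          using mix_dist[OF t, of x "v n" x y] by simp
        also have "\<dots> \<le> 1 * dist (v n) y"
          using t by (intro mult_right_mono) auto
        finally show ?thesis .
      qed
      then show "\<forall>\<^sub>F n in sequentially. dist (mix t x (v n)) (mix t x y) \<le> dist (v n) y"
        by simp
    qed
    have cont: "isCont f y" for y
      using f_cont by (simp add: continuous_on_eq_continuous_at)
    have "f (mix t x (v n)) = t * f x + (1 - t) * f (v n)" for n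
    proof -
      obtain k where "v n = z (Suc k)"
        using v(1)[of n] by (auto simp: z_def)
      then show ?thesis
        using f_z[OF t] by simp
    qed
    then have "(\<lambda>n. f (mix t x (v n))) \<longlonglongrightarrow> t * f x + (1 - t) * f y"
      using isCont_tendsto_compose[OF cont v(2)] by (auto intro!: tendsto_intros)
    then show ?thesis
      using isCont_tendsto_compose[OF cont mix] LIMSEQ_unique by blast
  qed
  have "f a = dist a b"
    by (rule LIMSEQ_unique[OF lim]) (simp add: H_a)
  \<comment> \<open>\<open>H n b\<close> decreases from \<open>dist b b = 0\<close>. Hence
    \<open>f a - f b\<close> is at least \<open>dist a b\<close>, and the Lipschitz bound gives
    equality.\<close>
  moreover have "f b \<le> 0"
    using decseq_ge[OF dec lim, of b 0] by (simp add: H_0)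
  ultimately have "f a - f b = dist a b"
    using f_abs[of a b] by linarith
  then show thesis
    using that cc_dualI[OF f_mix f_cont] f_Lip by blast
qed

text \<open>By continuity \<open>f\<close> varies by less than 1 on some ball about
  \<open>e\<close>. A point outside is pulled into the ball along the segment to \<open>e\<close>,
  and affinity scales the bound back.\<close>

lemma cc_dual_growth:
  assumes f: "f \<in> cc_dual cc"
  obtains C where "\<And>x. \<bar>f x\<bar> \<le> C + C * dist e x"
proof -
  have "isCont f e"
    using f by (simp add: cc_dual_def continuous_on_eq_continuous_at)
  then obtain r where r: "r > 0" "\<And>x. dist x e < r \<Longrightarrow> \<bar>f x - f e\<bar> < 1"
    unfolding continuous_at_eps_delta by (metis dist_real_def zero_less_one)
  have bound: "\<bar>f x - f e\<bar> \<le> 1 + 2 / r * dist e x" for x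
  proof (cases "dist x e < r")
    case True
    then show ?thesis
      using r by (smt (verit) divide_nonneg_nonneg mult_nonneg_nonneg zero_le_dist)
  next
    case False
    \<comment> \<open>Chosen so that \<open>mix t x e\<close> has distance at most
      \<open>r / 2\<close> from \<open>e\<close>.\<close>
    define t where "t = r / (2 * dist x e)"
    have d: "dist x e > 0"
      using False r by linarith
    have t: "t \<in> {0<..<1}"
      using False r d by (auto simp: t_def divide_simps)
    have "dist (mix t x e) e \<le> t * dist x e"
      using mix_dist[OF t, of x e e e] t by simp
    also have "\<dots> < r"
      using r d by (simp add: t_def)
    finally have "\<bar>f (mix t x e) - f e\<bar> < 1"
      by (rule r(2))
    also have "f (mix t x e) - f e = t * (f x - f e)"
      using cc_dual_mix[OF f t] by (simp add: algebra_simps)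
    finally have "\<bar>f x - f e\<bar> < 1 / t"
      using t unfolding abs_mult by (simp add: pos_less_divide_eq mult.commute)
    also have "1 / t = 2 / r * dist e x"
      by (simp add: t_def dist_commute)
    finally show ?thesis
      by simp
  qed
  define C where "C = \<bar>f e\<bar> + 1 + 2 / r"
  have "\<bar>f x\<bar> \<le> C + C * dist e x" for x
  proof -
    have "2 / r * dist e x \<le> C * dist e x"
      using r by (intro mult_right_mono) (auto simp: C_def)
    moreover have "\<bar>f e\<bar> + 1 \<le> C"
      using r by (simp add: C_def)
    ultimately show ?thesis
      using bound[of x] by linarith
  qed
  then show thesis
    by (rule that)
qed

end

section \<open>Expectations\<close>

lemma nearest_index:
  shows nearest_index_le: "nearest_index u n x \<le> n"
    and dist_nearest_approx_le: "j \<le> n \<Longrightarrow> dist (nearest_approx u n x) x \<le> dist (u j) x"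
proof -
  let ?S = "(\<lambda>j. dist (u j) x) ` {..n}"
  have "Min ?S \<in> ?S"
    by (intro Min_in) auto
  then have "\<exists>i. i \<le> n \<and> dist (u i) x = Min ?S"
    by (metis (no_types, lifting) atMost_iff imageE)
  from LeastI_ex[OF this] have *: "nearest_index u n x \<le> n" "dist (u (nearest_index u n x)) x = Min ?S"
    unfolding nearest_index_def by auto
  then show "nearest_index u n x \<le> n"
    by simp
  show "dist (nearest_approx u n x) x \<le> dist (u j) x" if "j \<le> n"
    unfolding nearest_approx_def *(2) using that by (intro Min_le) auto
qed

lemma measurable_nearest_index [measurable]:
  fixes u :: "nat \<Rightarrow> 'a::polish_space"
  shows "nearest_index u n \<in> borel \<rightarrow>\<^sub>M count_space UNIV"
  unfolding nearest_index_def by measurable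

lemma nearest_approx_tendsto:
  assumes "closure (range u) = UNIV"
  shows "(\<lambda>n. dist (nearest_approx u n x) x) \<longlonglongrightarrow> 0"
proof (rule LIMSEQ_I)
  fix e :: real
  assume "e > 0"
  moreover have "x \<in> closure (range u)"
    using assms by simp
  ultimately obtain j where "dist (u j) x < e"
    unfolding closure_approachable by auto
  then have "norm (dist (nearest_approx u n x) x - 0) < e" if "n \<ge> j" for n
    using dist_nearest_approx_le[of j n u x] that by simp
  then show "\<exists>k. \<forall>n\<ge>k. norm (dist (nearest_approx u n x) x - 0) < e"
    by blast
qed

section \<open>Expectations of simple random elements\<close>

locale random_cc_space = convexifiable_cc_space cc + prob_space M
  for cc :: "(real \<times> 'a::polish_space) list \<Rightarrow> 'a" and M :: "'w measure" +
  fixes u :: "nat \<Rightarrow> 'a"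
  assumes dense: "closure (range u) = UNIV"
begin

text \<open>The sequence \<open>u\<close> that defines the approximations also serves as the dense
  sequence in \<open>norming_functional\<close>.\<close>

lemma cc_dual_separates:
  assumes "\<And>f. f \<in> cc_dual cc \<Longrightarrow> f x = f y"
  shows "x = y"
proof -
  obtain f where f: "f \<in> cc_dual cc" and eq: "f x - f y = dist x y"
    by (rule norming_functional[OF dense, of x y])
  show ?thesis
    using eq unfolding assms[OF f] by simp
qed

text \<open>The integral does not involve the representation, which is the source of the
  well-definedness of the expectation.\<close>

lemma simple_representation_integral:
  assumes rep: "simple_representation M Y n A x" and f: "f \<in> cc_dual cc"
  shows "f (cc0 cc (map (\<lambda>i. (measure M (A i), convexification cc (x i))) [0..<n])) = (LINT \<omega>|M. f (Y \<omega>))"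
proof -
  have A: "A i \<in> sets M" "\<And>\<omega>. \<omega> \<in> A i \<Longrightarrow> Y \<omega> = x i" if "i < n" for i
    using rep that by (auto simp: simple_representation_def)
  have disj: "disjoint_family_on A {..<n}" and un: "(\<Union>i<n. A i) = space M"
    using rep by (auto simp: simple_representation_def)
  let ?xs = "map (\<lambda>i. (measure M (A i), x i)) [0..<n]"
  let ?ys = "filter (\<lambda>p. fst p \<noteq> 0) ?xs"
  \<comment> \<open>Discarded entries have weight zero, so they contribute nothing to weighted sums;
    the constant \<open>g = 1\<close> gives the total weight.\<close>
  have filter: "(\<Sum>p\<leftarrow>?ys. fst p * g (snd p)) = (\<Sum>i<n. measure M (A i) * g (x i))" for g
  proof -
    have "(\<Sum>p\<leftarrow>?ys. fst p * g (snd p)) = (\<Sum>p\<leftarrow>?xs. fst p * g (snd p))"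
      by (rule sum_list_map_filter) auto
    then show ?thesis
      by (simp add: o_def interv_sum_list_conv_sum_set_nat atLeast0LessThan)
  qed
  have "(\<Sum>i<n. measure M (A i)) = measure M (\<Union>i<n. A i)"
    using A disj by (intro finite_measure_finite_Union[symmetric]) auto
  then have "sum_list (map fst ?ys) = 1"
    using filter[of "\<lambda>_. 1"] by (simp add: un prob_space)
  then have "cc_weights ?ys"
    by (auto simp: cc_weights_def less_le)
  then have "f (cc ?ys) = (\<Sum>i<n. measure M (A i) * f (x i))"
    using cc_dual_sum[OF f] filter[of f] by (simp only:)
  also have "\<dots> = (LINT \<omega>|M. (\<Sum>i<n. indicat_real (A i) \<omega> * f (x i)))"
    using A by (subst Bochner_Integration.integral_sum) (auto simp: less_top[symmetric] Int_absorb1 sets.sets_into_space)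
  also have "\<dots> = (LINT \<omega>|M. f (Y \<omega>))"
  proof (rule Bochner_Integration.integral_cong[OF refl])
    fix \<omega>
    assume "\<omega> \<in> space M"
    then obtain i where i: "i < n" "\<omega> \<in> A i"
      using un by blast
    have "indicat_real (A j) \<omega> = (if j = i then 1 else 0)" if "j < n" for j
      using disj i that by (auto simp: disjoint_family_on_def indicator_def)
    then have "(\<Sum>j<n. indicat_real (A j) \<omega> * f (x j)) = (\<Sum>j<n. if j = i then f (x j) else 0)"
      by (intro sum.cong) auto
    also have "\<dots> = f (Y \<omega>)"
      using i A by simp
    finally show "(\<Sum>j<n. indicat_real (A j) \<omega> * f (x j)) = f (Y \<omega>)" .
  qed
  finally show ?thesis
    by (simp add: cc0_def)
qed

text \<open>Two candidates from different representations agree under every \<open>f\<close> in the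
  dual, so they coincide and the definite description denotes.\<close>

lemma simple_expectation_integral:
  assumes "simple_representation M Y n A x" and "f \<in> cc_dual cc"
  shows "f (simple_expectation cc M Y) = (LINT \<omega>|M. f (Y \<omega>))"
proof -
  define P where "P e \<longleftrightarrow> (\<exists>n A x. simple_representation M Y n A x \<and>
        e = cc0 cc (map (\<lambda>i. (measure M (A i), convexification cc (x i))) [0..<n]))" for e
  have P: "g e = (LINT \<omega>|M. g (Y \<omega>))" if "P e" "g \<in> cc_dual cc" for e g
    using that simple_representation_integral unfolding P_def by blast
  have "\<exists>e. P e"
    using assms(1) unfolding P_def by blast
  then have "\<exists>!e. P e"
    using P cc_dual_separates by metis
  then have "P (simple_expectation cc M Y)"
    unfolding simple_expectation_def P_def[symmetric] by (rule theI')
  then show ?thesis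
    using P assms(2) by blast
qed

lemma cc_dual_integrable:
  assumes f: "f \<in> cc_dual cc" and X[measurable]: "X \<in> borel_measurable M"
    and int: "integrable M (\<lambda>\<omega>. dist v (X \<omega>))"
  shows "integrable M (\<lambda>\<omega>. f (X \<omega>))"
proof -
  obtain C where C: "\<And>x. \<bar>f x\<bar> \<le> C + C * dist v x"
    using cc_dual_growth[OF f] by blast
  have "f \<in> borel_measurable borel"
    using f by (auto simp: cc_dual_def intro: borel_measurable_continuous_onI)
  then have meas: "(\<lambda>\<omega>. f (X \<omega>)) \<in> borel_measurable M"
    by measurable
  have bound: "integrable M (\<lambda>\<omega>. C + C * dist v (X \<omega>))"
    using int by simp
  have "norm (f (X \<omega>)) \<le> norm (C + C * dist v (X \<omega>))" for \<omega>
    using C[of "X \<omega>"] unfolding real_norm_def by linarith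
  then show ?thesis
    by (intro Bochner_Integration.integrable_bound[OF bound meas] AE_I2)
qed

section \<open>Limits of approximating expectations\<close>

context
  fixes X :: "'w \<Rightarrow> 'a"
  assumes X [measurable]: "X \<in> borel_measurable M"
    and int_X: "integrable M (\<lambda>\<omega>. dist (u 0) (X \<omega>))"
begin

abbreviation approx :: "nat \<Rightarrow> 'w \<Rightarrow> 'a" where
  "approx n \<omega> \<equiv> nearest_approx u n (X \<omega>)"

lemma approx_measurable [measurable]: "approx n \<in> borel_measurable M"
  unfolding nearest_approx_def by measurable

text \<open>Index 0 is a candidate for every \<open>n\<close>, which gives an integrable bound
  independent of \<open>n\<close>.\<close>

lemma dist_approx_le: "dist (approx n \<omega>) (X \<omega>) \<le> dist (u 0) (X \<omega>)"
  by (rule dist_nearest_approx_le) simp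

lemma dist_u0_approx_le: "dist (u 0) (approx n \<omega>) \<le> 2 * dist (u 0) (X \<omega>)"
  using dist_approx_le[of n \<omega>] dist_triangle2[of "u 0" "approx n \<omega>" "X \<omega>"] by simp

lemma integrable_dist_u0_approx: "integrable M (\<lambda>\<omega>. dist (u 0) (approx n \<omega>))"
  by (rule Bochner_Integration.integrable_bound[of M "\<lambda>\<omega>. 2 * dist (u 0) (X \<omega>)"])
     (use int_X dist_u0_approx_le in auto)

lemma integrable_dist_approx: "integrable M (\<lambda>\<omega>. dist (approx n \<omega>) (X \<omega>))"
  by (rule Bochner_Integration.integrable_bound[OF int_X]) (use dist_approx_le in auto)

lemma simple_representation_approx:
  "simple_representation M (approx n) (Suc n) (\<lambda>i. {\<omega> \<in> space M. nearest_index u n (X \<omega>) = i}) u"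
proof -
  have "{\<omega> \<in> space M. nearest_index u n (X \<omega>) = i} \<in> sets M" for i
    by measurable
  then show ?thesis
    using nearest_index_le[of u n]
    by (auto simp: simple_representation_def disjoint_family_on_def nearest_approx_def less_Suc_eq_le)
qed

abbreviation approx_expectation :: "nat \<Rightarrow> 'a" where
  "approx_expectation n \<equiv> simple_expectation cc M (\<lambda>\<omega>. approx n \<omega>)"

lemma cc_dual_approx_expectation:
  assumes "f \<in> cc_dual cc"
  shows "f (approx_expectation n) = (LINT \<omega>|M. f (approx n \<omega>))"
  using simple_expectation_integral[OF simple_representation_approx assms] .

lemma approx_integral_tendsto:
  assumes f: "f \<in> cc_dual cc"
  shows "(\<lambda>n. LINT \<omega>|M. f (approx n \<omega>)) \<longlonglongrightarrow> (LINT \<omega>|M. f (X \<omega>))"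
proof -
  obtain C where C: "\<And>x. \<bar>f x\<bar> \<le> C + C * dist (u 0) x"
    using cc_dual_growth[OF f] by blast
  \<comment> \<open>At \<open>u 0\<close> the bound reads
    \<open>\<bar>f (u 0)\<bar> \<le> C\<close>; the sign allows enlarging the distance multiplied by
    \<open>C\<close>.\<close>
  have "C \<ge> 0"
    using C[of "u 0"] by simp
  have cont: "isCont f x" for x
    using f by (simp add: cc_dual_def continuous_on_eq_continuous_at)
  show ?thesis
  proof (rule integral_dominated_convergence)
    show "(\<lambda>\<omega>. f (X \<omega>)) \<in> borel_measurable M" "(\<lambda>\<omega>. f (approx n \<omega>)) \<in> borel_measurable M" for n
      using cc_dual_integrable[OF f X int_X]
        cc_dual_integrable[OF f approx_measurable integrable_dist_u0_approx]
      by (auto dest: borel_measurable_integrable)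
    show "integrable M (\<lambda>\<omega>. C + C * (2 * dist (u 0) (X \<omega>)))"
      using int_X by simp
    show "AE \<omega> in M. (\<lambda>n. f (approx n \<omega>)) \<longlonglongrightarrow> f (X \<omega>)"
      using nearest_approx_tendsto[OF dense]
      by (intro AE_I2 isCont_tendsto_compose[OF cont]) (simp only: tendsto_dist_iff[symmetric])
    have "\<bar>f (approx n \<omega>)\<bar> \<le> C + C * (2 * dist (u 0) (X \<omega>))" for n \<omega>
      using C[of "approx n \<omega>"] mult_left_mono[OF dist_u0_approx_le \<open>C \<ge> 0\<close>, of n \<omega>] by linarith
    then show "AE \<omega> in M. norm (f (approx n \<omega>)) \<le> C + C * (2 * dist (u 0) (X \<omega>))" for n
      by simp
  qed
qed

text \<open>A functional norming this pair of expectations turns their distance into an integral,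
  whose integrand is estimated pointwise through \<open>X\<close>.\<close>

lemma dist_approx_expectation_le:
  "dist (approx_expectation n) (approx_expectation k)
    \<le> (LINT \<omega>|M. dist (approx n \<omega>) (X \<omega>)) + (LINT \<omega>|M. dist (approx k \<omega>) (X \<omega>))"
proof -
  obtain f where f: "f \<in> cc_dual cc" "\<And>x y. f x \<le> f y + dist x y"
    and eq: "f (approx_expectation n) - f (approx_expectation k)
      = dist (approx_expectation n) (approx_expectation k)"
    using norming_functional[OF dense] by metis
  have int: "integrable M (\<lambda>\<omega>. f (approx n \<omega>))" for n
    using cc_dual_integrable[OF f(1) approx_measurable integrable_dist_u0_approx] .
  have "dist (approx_expectation n) (approx_expectation k)
      = (LINT \<omega>|M. f (approx n \<omega>) - f (approx k \<omega>))"
    unfolding eq[symmetric] by (simp add: cc_dual_approx_expectation[OF f(1)] int)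
  also have "\<dots> \<le> (LINT \<omega>|M. dist (approx n \<omega>) (X \<omega>) + dist (approx k \<omega>) (X \<omega>))"
  proof (rule integral_mono)
    show "f (approx n \<omega>) - f (approx k \<omega>) \<le> dist (approx n \<omega>) (X \<omega>) + dist (approx k \<omega>) (X \<omega>)" for \<omega>
      using f(2)[of "approx n \<omega>" "approx k \<omega>"] dist_triangle2[of "approx n \<omega>" "approx k \<omega>" "X \<omega>"]
      by linarith
  qed (auto intro: int integrable_dist_approx)
  also have "\<dots> = (LINT \<omega>|M. dist (approx n \<omega>) (X \<omega>)) + (LINT \<omega>|M. dist (approx k \<omega>) (X \<omega>))"
    by (simp add: integrable_dist_approx)
  finally show ?thesis .
qed

lemma approx_expectation_convergent: "convergent approx_expectation"
proof -
  have lim: "(\<lambda>n. LINT \<omega>|M. dist (approx n \<omega>) (X \<omega>)) \<longlonglongrightarrow> (LINT \<omega>|M. 0)"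
  proof (rule integral_dominated_convergence[OF _ _ int_X])
    show "AE \<omega> in M. (\<lambda>n. dist (approx n \<omega>) (X \<omega>)) \<longlonglongrightarrow> 0"
      by (intro AE_I2 nearest_approx_tendsto dense)
  qed (use dist_approx_le in auto)
  have "Cauchy approx_expectation"
  proof (rule metric_CauchyI)
    fix e :: real
    assume "e > 0"
    then have "\<forall>\<^sub>F n in sequentially. (LINT \<omega>|M. dist (approx n \<omega>) (X \<omega>)) < e / 2"
      using order_tendstoD(2)[OF lim, of "e / 2"] by simp
    then obtain N where N: "\<And>n. n \<ge> N \<Longrightarrow> (LINT \<omega>|M. dist (approx n \<omega>) (X \<omega>)) < e / 2"
      by (auto simp: eventually_sequentially)
    have "dist (approx_expectation n) (approx_expectation k) < e" if "n \<ge> N" "k \<ge> N" for n k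
      using dist_approx_expectation_le[of n k] N[OF that(1)] N[OF that(2)] by linarith
    then show "\<exists>N. \<forall>n\<ge>N. \<forall>k\<ge>N. dist (approx_expectation n) (approx_expectation k) < e"
      by blast
  qed
  then show ?thesis
    by (rule Cauchy_convergent)
qed

text \<open>Every limit of the approximating expectations satisfies the integral identities by
  continuity of \<open>f\<close>. Conversely, some limit \<open>m'\<close> exists, and a point
  satisfying the same identities cannot be separated from it.\<close>

lemma is_expectation_iff:
  "is_expectation cc u M X m \<longleftrightarrow> (\<forall>f\<in>cc_dual cc. f m = (LINT \<omega>|M. f (X \<omega>)))"
proof -
  have dual: "f m = (LINT \<omega>|M. f (X \<omega>))"
    if "approx_expectation \<longlonglongrightarrow> m" and f: "f \<in> cc_dual cc" for m f
  proof -
    have "isCont f m"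
      using f by (simp add: cc_dual_def continuous_on_eq_continuous_at)
    then have "(\<lambda>n. f (approx_expectation n)) \<longlonglongrightarrow> f m"
      using that(1) by (rule isCont_tendsto_compose)
    then show ?thesis
      using approx_integral_tendsto[OF f] LIMSEQ_unique
      unfolding cc_dual_approx_expectation[OF f] by blast
  qed
  obtain m' where m': "approx_expectation \<longlonglongrightarrow> m'"
    using approx_expectation_convergent by (auto simp: convergent_def)
  show ?thesis
  proof
    assume "is_expectation cc u M X m"
    then show "\<forall>f\<in>cc_dual cc. f m = (LINT \<omega>|M. f (X \<omega>))"
      using dual by (simp add: is_expectation_def)
  next
    assume "\<forall>f\<in>cc_dual cc. f m = (LINT \<omega>|M. f (X \<omega>))"
    then have "m = m'"
      using dual[OF m'] by (intro cc_dual_separates) simp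
    then show "is_expectation cc u M X m"
      using m' by (simp add: is_expectation_def)
  qed
qed

end

end

theorem theorem4p4:
  fixes cc :: "(real \<times> 'a::polish_space) list \<Rightarrow> 'a"
    and u :: "nat \<Rightarrow> 'a"
    and M :: "'w measure"
    and X :: "'w \<Rightarrow> 'a"
  assumes "prob_space M" and "complete_measure M" and "atomless M"
    and "cc_space cc" and "cc_convexifiable cc"
    and "approximating_sequence cc u"
    and "integrable_element M X"
  shows "(\<forall>f\<in>cc_dual cc. integrable M (\<lambda>\<omega>. f (X \<omega>))) \<and>
         (\<forall>m. is_expectation cc u M X m \<longleftrightarrow>
            (\<forall>f\<in>cc_dual cc. f m = (LINT \<omega>|M. f (X \<omega>))))"
proof -
  have "closure (u ` {1..}) = UNIV"
    using assms(6) by (simp add: approximating_sequence_def)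
  then have "closure (range u) = UNIV"
    using closure_mono[of "u ` {1..}" "range u"] by auto
  then interpret random_cc_space cc M u
    using assms by (intro random_cc_space.intro convexifiable_cc_space.intro
        convexifiable_cc_space_axioms.intro random_cc_space_axioms.intro)
  have X [measurable]: "X \<in> borel_measurable M"
    using assms(7) by (simp add: integrable_element_def random_element_def)
  obtain v where v: "integrable M (\<lambda>\<omega>. dist v (X \<omega>))"
    using assms(7) by (auto simp: integrable_element_def)
  \<comment> \<open>Integrability is given for some base point \<open>v\<close>; the triangle
    inequality moves it to \<open>u 0\<close>.\<close>
  have "integrable M (\<lambda>\<omega>. dist (u 0) v + dist v (X \<omega>))"
    using v by simp
  then have "integrable M (\<lambda>\<omega>. dist (u 0) (X \<omega>))"
    by (rule Bochner_Integration.integrable_bound) (auto intro!: AE_I2 dist_triangle)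
  then show ?thesis
    using is_expectation_iff[OF X] cc_dual_integrable[OF _ X v] by blast
qed

end
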